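(* Let $q=p^r$ with $p$ prime and $r\ge1$. Then $$\Big(1-\frac1q\Big)\Big((q-1)!-\frac{1}{q-1}q^{\frac q2}\Big)\le N_q(q-2)\le\Big(1-\frac1q\Big)\Big((q-1)!+\frac1{q-1}q^{\frac q2}\Big).$$
   Context: $\mathbf{F}_q$ is the finite field with $q=p^r$ elements. A polynomial $f$ over $\mathbf{F}_q$ is a permutation polynomial if $\alpha\mapsto f(\alpha)$ is a permutation of $\mathbf{F}_q$. $N_q(d)$ denotes the number of permutation polynomials $f$ over $\mathbf{F}_q$ with $\deg f=d$ and $f(0)=0$. *)

theory Defs
  imports Complex_Main "HOL-Computational_Algebra.Computational_Algebra"
begin

text \<open>
  The finite field with \<open>q\<close> elements is rendered as a type \<open>'a\<close> of classes
  \<^class>\<open>field\<close> and \<^class>\<open>finite\<close> with \<open>card (UNIV :: 'a set) = q\<close>.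
\<close>

definition permutation_poly :: "'a::{field,finite} poly \<Rightarrow> bool" where
  "permutation_poly f \<longleftrightarrow> bij (poly f)"

text \<open>
  The zero polynomial has \<^const>\<open>degree\<close> \<open>0\<close> here, but it is never counted, as it is not
  a permutation polynomial. The field is passed as a type token because the result type
  does not mention it.
\<close>

definition num_permutation_polys :: "'a::{field,finite} itself \<Rightarrow> nat \<Rightarrow> nat" where
  "num_permutation_polys _ d =
     card {f :: 'a poly. permutation_poly f \<and> degree f = d \<and> poly f 0 = 0}"

end

theory Submission
  imports
    Defs
    "HOL-Analysis.Complex_Transcendental"
    "HOL-Combinatorics.Permutations"
    "HOL-Number_Theory.Cong"
    "HOL-Library.Cardinality"
begin

text \<open>
  For \<open>q > 2\<close>, Lagrange interpolation writes a permutation \<open>\<sigma>\<close> of the field as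
  \<open>\<Sum>c. \<sigma> c * (1 - (X - c)^(q-1))\<close>. The coefficient of \<open>X^(q-1)\<close> is minus the sum of all field
  elements, hence zero, and that of \<open>X^(q-2)\<close> is \<open>- (\<Sum>c. c * \<sigma> c)\<close>. So the polynomials to be
  counted correspond to the permutations fixing \<open>0\<close> whose first moment \<open>\<Sum>c. c * \<sigma> c\<close> is nonzero.
  Adding a constant to \<open>\<sigma>\<close> does not change the moment, so \<open>q * N\<close> is the number of all
  permutations with nonzero moment, i.e. \<open>q! - S\<close>, where \<open>S\<close> counts those with moment zero.

  To estimate \<open>S\<close>, detect the equation by a nontrivial additive character \<open>\<psi>\<close>:
  \<open>q * S = (\<Sum>t. \<Sum>\<sigma>. \<psi> (t * (\<Sum>c. c * \<sigma> c)))\<close>, and the inner sum is the permanent of the matrix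
  \<open>A t c d = \<psi> (t * (c * d))\<close>. The term \<open>t = 0\<close> contributes \<open>q!\<close>. For \<open>t \<noteq> 0\<close> the matrix
  is \<open>sqrt q\<close> times a unitary one, and the permanent of a unitary matrix has absolute value at
  most one, so each of the other \<open>q - 1\<close> terms is at most \<open>q powr (q/2)\<close>
  (\<open>norm_permanent_character_le\<close>). This gives \<open>\<bar>q * S - q!\<bar> \<le> (q - 1) * q powr (q/2)\<close>, which is
  stronger than needed by a factor \<open>q / (q - 1)\<close>.

  The bound on the permanent (\<open>norm_permanent_le\<close>) comes from Glynn's formula, which presents the
  permanent of \<open>A\<close> as the average of \<open>\<Prod>i. x i * (A x) i\<close> over all sign vectors \<open>x\<close>. Each
  term is controlled by the arithmetic-geometric mean inequality, since unitarity fixes the Euclidean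
  length of \<open>A x\<close>. The character \<open>\<psi>\<close> is a root of unity raised to the trace.

  For \<open>q = 2\<close> the degree in question is \<open>0\<close>, so the count is zero and the bounds are immediate.
\<close>

section \<open>Permanents of matrices with orthogonal columns\<close>

definition permanent :: "('n::finite \<Rightarrow> 'n \<Rightarrow> complex) \<Rightarrow> complex" where
  "permanent A = (\<Sum>\<sigma> | bij \<sigma>. \<Prod>i\<in>UNIV. A i (\<sigma> i))"

abbreviation sign_vectors :: "('n::finite \<Rightarrow> complex) set" where
  "sign_vectors \<equiv> PiE UNIV (\<lambda>_. {1, -1})"

lemma card_sign_vectors: "card (sign_vectors :: ('n::finite \<Rightarrow> complex) set) = 2 ^ CARD('n)"
  by (simp add: card_PiE flip: numeral_2_eq_2)

text \<open>
  If \<open>g\<close> is a bijection, the product is \<open>(\<Prod>i. x i)\<^sup>2 = 1\<close>. Otherwise some index \<open>j\<close> is missed by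
  \<open>g\<close>, so that \<open>x j\<close> occurs exactly once in the product, and flipping its sign pairs off the
  terms of the sum.
\<close>

lemma sum_sign_vectors_map:
  fixes g :: "'n::finite \<Rightarrow> 'n"
  shows "(\<Sum>x\<in>sign_vectors. \<Prod>i\<in>UNIV. x i * x (g i)) = (if bij g then 2 ^ CARD('n) else 0 :: complex)"
proof (cases "bij g")
  case True
  have "(\<Prod>i\<in>UNIV. x i * x (g i)) = 1" if "x \<in> sign_vectors" for x :: "'n \<Rightarrow> complex"
  proof -
    have "(\<Prod>i\<in>UNIV. x (g i)) = (\<Prod>i\<in>UNIV. x i)"
      using True by (rule prod.reindex_bij_betw)
    then have "(\<Prod>i\<in>UNIV. x i * x (g i)) = (\<Prod>i\<in>UNIV. x i * x i)"
      by (simp add: prod.distrib)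
    also have "\<dots> = (\<Prod>i\<in>(UNIV :: 'n set). 1)"
    proof (rule prod.cong)
      fix i show "x i * x i = 1"
        using that by (cases "x i = 1") (auto simp: PiE_iff)
    qed simp
    finally show ?thesis by simp
  qed
  then show ?thesis
    using True card_sign_vectors[where 'n='n] by simp
next
  case False
  then have "\<not> surj g"
    using finite_UNIV_surj_inj[of g] by (auto simp: bij_def)
  then obtain j where j: "\<And>i. g i \<noteq> j"
    by (metis surjI)
  define flip :: "('n \<Rightarrow> complex) \<Rightarrow> 'n \<Rightarrow> complex" where "flip x = x(j := - x j)" for x
  let ?h = "\<lambda>x::'n \<Rightarrow> complex. \<Prod>i\<in>UNIV. x i * x (g i)"
  have flip: "?h (flip x) = - ?h x" for x
  proof -
    have "?h y = y j * (\<Prod>i\<in>UNIV - {j}. y i) * (\<Prod>i\<in>UNIV. y (g i))" for y :: "'n \<Rightarrow> complex"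
      by (simp add: prod.distrib flip: prod.remove)
    moreover have "(\<Prod>i\<in>UNIV - {j}. flip x i) = (\<Prod>i\<in>UNIV - {j}. x i)"
      by (intro prod.cong) (auto simp: flip_def)
    moreover have "(\<Prod>i\<in>UNIV. flip x (g i)) = (\<Prod>i\<in>UNIV. x (g i))"
      using j by (simp add: flip_def)
    moreover have "flip x j = - x j"
      by (simp add: flip_def)
    ultimately show ?thesis by simp
  qed
  have "(\<Sum>x\<in>sign_vectors. ?h x) = (\<Sum>x\<in>sign_vectors. ?h (flip x))"
    by (rule sum.reindex_bij_witness[of _ flip flip]) (auto simp: flip_def PiE_iff)
  also have "\<dots> = - (\<Sum>x\<in>sign_vectors. ?h x)"
    by (simp only: flip sum_negf)
  finally show ?thesis
    using False by simp
qed

text \<open>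
  Glynn's formula: expanding the product of the row sums gives one term for each map \<open>g\<close> on the
  indices, and summing over the signs \<open>x\<close> keeps exactly the bijective ones.
\<close>

lemma permanent_eq_sum_sign_vectors:
  fixes A :: "'n::finite \<Rightarrow> 'n \<Rightarrow> complex"
  shows "2 ^ CARD('n) * permanent A = (\<Sum>x\<in>sign_vectors. \<Prod>i\<in>UNIV. x i * (\<Sum>j\<in>UNIV. A i j * x j))"
proof -
  have "(\<Sum>x\<in>sign_vectors. \<Prod>i\<in>UNIV. x i * (\<Sum>j\<in>UNIV. A i j * x j))
      = (\<Sum>x\<in>sign_vectors. \<Prod>i\<in>UNIV. \<Sum>j\<in>UNIV. A i j * (x i * x j))"
    by (simp add: sum_distrib_left mult_ac)
  also have "\<dots> = (\<Sum>x\<in>sign_vectors. \<Sum>g\<in>UNIV. \<Prod>i\<in>UNIV. A i (g i) * (x i * x (g i)))"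
    by (subst prod_sum_PiE) (auto simp: PiE_UNIV_domain)
  also have "\<dots> = (\<Sum>g\<in>UNIV. (\<Prod>i\<in>UNIV. A i (g i)) * (\<Sum>x\<in>sign_vectors. \<Prod>i\<in>UNIV. x i * x (g i)))"
    by (subst sum.swap) (simp add: prod.distrib sum_distrib_left)
  also have "\<dots> = (\<Sum>g\<in>UNIV. if bij g then 2 ^ CARD('n) * (\<Prod>i\<in>UNIV. A i (g i)) else 0)"
    unfolding sum_sign_vectors_map by (intro sum.cong) auto
  also have "\<dots> = 2 ^ CARD('n) * permanent A"
    by (simp add: permanent_def sum_distrib_left flip: sum.inter_filter)
  finally show ?thesis ..
qed

text \<open>
  The arithmetic-geometric mean inequality, applied to the numbers \<open>(norm (y i))\<^sup>2\<close>, whose mean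
  is \<open>N\<close>.
\<close>

lemma prod_norm_le_of_sum_norm_sq:
  fixes y :: "'n::finite \<Rightarrow> complex"
  assumes "(\<Sum>i\<in>UNIV. (norm (y i))\<^sup>2) = N * real CARD('n)"
  shows "(\<Prod>i\<in>UNIV. norm (y i)) \<le> sqrt N ^ CARD('n)"
proof -
  let ?n = "CARD('n)" and ?P = "\<Prod>i\<in>UNIV. (norm (y i))\<^sup>2"
  have n: "real ?n > 0" by simp
  have P: "?P \<ge> 0" by (simp add: prod_nonneg)
  have N0: "N \<ge> 0"
  proof -
    have "0 \<le> N * real ?n"
      unfolding assms[symmetric] by (intro sum_nonneg) simp
    then show ?thesis using n by (simp add: zero_le_mult_iff)
  qed
  have "?P powr (1 / ?n) \<le> (\<Sum>i\<in>UNIV. (norm (y i))\<^sup>2 / ?n)"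
    by (rule arith_geom_mean) auto
  also have "\<dots> = N"
    using n by (simp add: assms flip: sum_divide_distrib)
  finally have "(?P powr (1 / ?n)) ^ ?n \<le> N ^ ?n"
    by (rule power_mono) simp
  moreover have "(?P powr (1 / ?n)) ^ ?n = ?P"
  proof (cases "?P = 0")
    case False
    then show ?thesis
      using P n by (subst powr_power) auto
  next
    case True
    show ?thesis
      unfolding True by (simp add: power_0_left)
  qed
  ultimately have "(\<Prod>i\<in>UNIV. norm (y i))\<^sup>2 \<le> (sqrt N ^ ?n)\<^sup>2"
    using N0 by (simp add: prod_power_distrib power_mult[symmetric] mult.commute[of _ 2])
      (simp add: power_mult)
  then show ?thesis
    by (rule power2_le_imp_le) (simp add: N0)
qed

text \<open>
  Orthogonality of the columns, each of squared length \<open>N\<close>, forces the image of every sign vector to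
  have squared length \<open>N * CARD('n)\<close>. Hence every term of Glynn's formula obeys the bound, and so
  does their average.
\<close>

theorem norm_permanent_le:
  fixes A :: "'n::finite \<Rightarrow> 'n \<Rightarrow> complex"
  assumes orth: "\<And>j k. (\<Sum>i\<in>UNIV. A i j * cnj (A i k)) = (if j = k then of_real N else 0)"
  shows "norm (permanent A) \<le> sqrt N ^ CARD('n)"
proof -
  have bound: "norm (\<Prod>i\<in>UNIV. x i * (\<Sum>j\<in>UNIV. A i j * x j)) \<le> sqrt N ^ CARD('n)"
    if x: "x \<in> sign_vectors" for x :: "'n \<Rightarrow> complex"
  proof -
    let ?y = "\<lambda>i. \<Sum>j\<in>UNIV. A i j * x j"
    have x1: "norm (x i) = 1" and x2: "x i * cnj (x i) = 1" for i
    proof -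
      have "x i \<in> {1, -1}"
        using x by (simp add: PiE_iff)
      then show "norm (x i) = 1" "x i * cnj (x i) = 1"
        by auto
    qed
    have "of_real (\<Sum>i\<in>UNIV. (norm (?y i))\<^sup>2) = (\<Sum>i\<in>UNIV. ?y i * cnj (?y i))"
      unfolding of_real_sum complex_norm_square ..
    also have "\<dots> = (\<Sum>i\<in>UNIV. \<Sum>j\<in>UNIV. \<Sum>k\<in>UNIV. x j * cnj (x k) * (A i j * cnj (A i k)))"
      by (simp add: sum_product mult_ac)
    also have "\<dots> = (\<Sum>j\<in>UNIV. \<Sum>i\<in>UNIV. \<Sum>k\<in>UNIV. x j * cnj (x k) * (A i j * cnj (A i k)))"
      by (rule sum.swap)
    also have "\<dots> = (\<Sum>j\<in>UNIV. \<Sum>k\<in>UNIV. \<Sum>i\<in>UNIV. x j * cnj (x k) * (A i j * cnj (A i k)))"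
      by (intro sum.cong refl sum.swap)
    also have "\<dots> = (\<Sum>j\<in>UNIV. \<Sum>k\<in>UNIV. x j * cnj (x k) * (if j = k then of_real N else 0))"
      by (simp add: orth flip: sum_distrib_left)
    also have "\<dots> = (\<Sum>j\<in>(UNIV :: 'n set). \<Sum>k\<in>UNIV. if j = k then of_real N else 0)"
      by (intro sum.cong) (auto simp: x2)
    also have "\<dots> = of_real (N * real CARD('n))"
      by simp
    finally have "(\<Sum>i\<in>UNIV. (norm (?y i))\<^sup>2) = N * real CARD('n)"
      by (simp only: of_real_eq_iff)
    from prod_norm_le_of_sum_norm_sq[OF this]
    show ?thesis
      by (simp add: prod_norm[symmetric] norm_mult x1)
  qed
  have "2 ^ CARD('n) * norm (permanent A) = norm (2 ^ CARD('n) * permanent A)"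
    by (simp add: norm_mult norm_power)
  also have "\<dots> \<le> (\<Sum>x\<in>(sign_vectors :: ('n \<Rightarrow> complex) set). sqrt N ^ CARD('n))"
    unfolding permanent_eq_sum_sign_vectors by (intro sum_norm_le bound)
  also have "\<dots> = 2 ^ CARD('n) * sqrt N ^ CARD('n)"
    using card_sign_vectors[where 'n='n] by simp
  finally show ?thesis by simp
qed

section \<open>Characters of the additive group of a finite field\<close>

text \<open>
  Multiplication by \<open>x\<close> permutes the nonzero elements, so it does not change their product.
\<close>

lemma power_card_minus_1_eq_1:
  fixes x :: "'a::{field,finite}"
  assumes "x \<noteq> 0"
  shows "x ^ (CARD('a) - 1) = 1"
proof -
  have "(\<Prod>y\<in>UNIV - {0}. x * y) = \<Prod>(UNIV - {0})"
    by (rule prod.reindex_bij_witness[of _ "\<lambda>y. y / x" "\<lambda>y. x * y"]) (use assms in auto)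
  then have "x ^ (CARD('a) - 1) * \<Prod>(UNIV - {0}) = \<Prod>(UNIV - {0 :: 'a})"
    by (simp add: prod.distrib card_Diff_singleton)
  then show ?thesis by simp
qed

lemma power_card_eq_same:
  fixes x :: "'a::{field,finite}"
  shows "x ^ CARD('a) = x"
proof (cases "x = 0")
  case False
  have "x ^ CARD('a) = x * x ^ (CARD('a) - 1)"
    by (simp flip: power_Suc)
  with False show ?thesis
    by (simp only: power_card_minus_1_eq_1 mult_1_right not_False_eq_True)
qed simp

text \<open>
  The translation by \<open>1\<close> permutes the field, so it does not change the sum of all elements.
\<close>

lemma of_nat_card_eq_0: "of_nat CARD('a) = (0 :: 'a::{field,finite})"
proof -
  have "(\<Sum>x\<in>UNIV. x) = (\<Sum>x\<in>UNIV. x + 1 :: 'a)"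
    by (rule sum.reindex_bij_witness[of _ "\<lambda>x. x + 1" "\<lambda>x. x - 1"]) auto
  then show ?thesis
    by (simp add: sum.distrib)
qed

lemma CHAR_eq_if_card_prime_power:
  assumes "prime p" and "CARD('a::{field,finite}) = p ^ r"
  shows "CHAR('a) = p"
proof -
  have "prime CHAR('a)"
    by (intro prime_CHAR_semidom finite_imp_CHAR_pos) simp
  moreover have "CHAR('a) dvd p ^ r"
    using of_nat_card_eq_0[where 'a='a] unfolding assms(2) of_nat_eq_0_iff_char_dvd .
  ultimately show ?thesis
    using assms(1) by (metis prime_dvd_power primes_dvd_imp_eq)
qed

text \<open>
  The prime field consists of \<open>p\<close> roots of \<open>X^p - X\<close>, and there are no further roots.
\<close>

lemma frobenius_fixed_imp_of_nat:
  fixes y :: "'a::{field,finite}"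
  assumes p: "CHAR('a) = p" "prime p" and y: "y ^ p = y"
  obtains k where "y = of_nat k"
proof -
  define P :: "'a poly" where "P = monom 1 p - monom 1 1"
  have p1: "p > 1"
    using p(2) prime_gt_1_nat by auto
  have coeff: "coeff P p = 1"
    using p1 by (simp add: P_def)
  have deg: "degree P \<le> p"
    unfolding P_def using p1 by (intro degree_diff_le) (auto simp: degree_monom_eq)
  have roots: "{x. poly P x = 0} = {x. x ^ p = x}"
    by (simp add: P_def poly_monom)
  have "card {x. poly P x = 0} \<le> p"
    using card_poly_roots_bound[of P] coeff deg by force
  moreover have "card (of_nat ` {..<p} :: 'a set) = p"
  proof -
    have "inj_on (of_nat :: nat \<Rightarrow> 'a) {..<p}"
      by (auto simp: inj_on_def of_nat_eq_iff_cong_CHAR p cong_def)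
    then show ?thesis by (simp add: card_image)
  qed
  moreover have "(of_nat k :: 'a) ^ p = of_nat k" for k
    using p p1 by (induction k) (simp_all add: freshmans_dream)
  ultimately have "of_nat ` {..<p} = {x::'a. x ^ p = x}"
    by (intro card_seteq) (auto simp: roots)
  with y that show ?thesis by blast
qed

text \<open>
  For a field with \<open>p ^ r\<close> elements this is the absolute trace, i.e. the trace to the prime field, written
  as the sum of the conjugates.
\<close>

definition field_trace :: "nat \<Rightarrow> nat \<Rightarrow> 'a::field \<Rightarrow> 'a" where
  "field_trace p r x = (\<Sum>i<r. x ^ (p ^ i))"

lemma field_trace_add:
  assumes "CHAR('a::field) = p" "prime p"
  shows "field_trace p r (x + y :: 'a) = field_trace p r x + field_trace p r y"
  using assms by (simp add: field_trace_def freshmans_dream' sum.distrib)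

text \<open>
  Raising to the power \<open>p\<close> permutes the conjugates cyclically, because \<open>x ^ (p ^ r) = x\<close>.
  So the trace takes its values in the prime field.
\<close>

lemma field_trace_frobenius:
  fixes x :: "'a::{field,finite}"
  assumes "CHAR('a) = p" "prime p" "CARD('a) = p ^ r"
  shows "field_trace p r x ^ p = field_trace p r x"
proof -
  have "field_trace p r x ^ p = (\<Sum>i<r. x ^ (p ^ Suc i))"
    unfolding field_trace_def using assms
    by (subst freshmans_dream_sum) (simp_all add: mult.commute flip: power_mult)
  also have "\<dots> = (\<Sum>i<Suc r. x ^ (p ^ i)) - x"
    by (subst sum.lessThan_Suc_shift) simp
  also have "\<dots> = field_trace p r x"
    using power_card_eq_same[of x] assms(3) by (simp add: field_trace_def)
  finally show ?thesis .
qed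

text \<open>
  The trace is a polynomial function of degree \<open>p ^ (r - 1)\<close>, too small to vanish on the whole
  field.
\<close>

lemma field_trace_nonzero:
  assumes p: "prime p" and r: "r \<ge> 1" and card: "CARD('a::{field,finite}) = p ^ r"
  shows "\<exists>x::'a. field_trace p r x \<noteq> 0"
proof (rule ccontr)
  define P :: "'a poly" where "P = (\<Sum>i<r. monom 1 (p ^ i))"
  have p1: "p > 1"
    using p prime_gt_1_nat by auto
  assume "\<not> ?thesis"
  then have "{x. poly P x = 0} = UNIV"
    by (auto simp: P_def field_trace_def poly_sum poly_monom)
  moreover have "P \<noteq> 0"
  proof -
    have "coeff P (p ^ (r - 1)) = (\<Sum>i<r. if i = r - 1 then 1 else 0)"
      unfolding P_def coeff_sum using p1 by (intro sum.cong) auto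
    with r show ?thesis by auto
  qed
  moreover have "degree P \<le> p ^ (r - 1)"
    unfolding P_def using p1
    by (intro degree_sum_le) (auto simp: degree_monom_eq intro!: power_increasing)
  ultimately have "p ^ r \<le> p ^ (r - 1)"
    using card_poly_roots_bound[of P] card by simp
  with p1 r show False by simp
qed

definition additive_character :: "('a::ring \<Rightarrow> complex) \<Rightarrow> bool" where
  "additive_character \<psi> \<longleftrightarrow> (\<forall>x y. \<psi> (x + y) = \<psi> x * \<psi> y) \<and> (\<forall>x. norm (\<psi> x) = 1)"

lemma exists_nontrivial_additive_character:
  assumes p: "prime p" and r: "r \<ge> 1" and card: "CARD('a::{field,finite}) = p ^ r"
  obtains \<psi> :: "'a::{field,finite} \<Rightarrow> complex" and z where "additive_character \<psi>" and "\<psi> z \<noteq> 1"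
proof -
  have char: "CHAR('a) = p"
    using p card by (rule CHAR_eq_if_card_prime_power)
  have p0: "p > 0"
    using p prime_gt_0_nat by auto
  have "\<exists>k. field_trace p r x = of_nat k" for x :: 'a
    using frobenius_fixed_imp_of_nat[OF char p field_trace_frobenius[OF char p card, of x]]
    by metis
  then obtain k where k: "\<And>x::'a. field_trace p r x = of_nat (k x)"
    by metis
  define \<psi> :: "'a \<Rightarrow> complex" where "\<psi> x = cis (2 * pi * (real (k x) / real p))" for x
  \<comment> \<open>The value does not depend on the choice of the representative \<open>k x\<close> of the trace.\<close>
  have cis_cong: "cis (2 * pi * (real a / real p)) = cis (2 * pi * (real b / real p)) \<longleftrightarrow> [a = b] (mod p)" for a b
    using complex_root_unity_eq[of p a b] p0 by (simp add: cis_conv_exp cong_def mult_ac)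
  have "\<psi> (x + y) = \<psi> x * \<psi> y" for x y
  proof -
    have "(of_nat (k (x + y)) :: 'a) = of_nat (k x + k y)"
      using field_trace_add[OF char p, of r x y] by (simp add: k)
    then have "[k (x + y) = k x + k y] (mod p)"
      unfolding of_nat_eq_iff_cong_CHAR char .
    then have "\<psi> (x + y) = cis (2 * pi * (real (k x + k y) / real p))"
      unfolding \<psi>_def cis_cong .
    then show ?thesis
      by (simp add: \<psi>_def cis_mult ring_distribs add_divide_distrib)
  qed
  then have "additive_character \<psi>"
    by (simp add: additive_character_def \<psi>_def)
  moreover obtain z :: 'a where "field_trace p r z \<noteq> 0"
    using field_trace_nonzero[OF p r card] by blast
  then have "\<psi> z \<noteq> 1"
    using cis_cong[of "k z" 0] by (simp add: \<psi>_def k of_nat_eq_0_iff_char_dvd char cong_0_iff)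
  ultimately show ?thesis by (rule that)
qed

lemma additive_character_zero:
  assumes "additive_character \<psi>"
  shows "\<psi> 0 = 1"
proof -
  have "\<psi> (0 + 0) = \<psi> 0 * \<psi> 0" and "norm (\<psi> 0) = 1"
    using assms unfolding additive_character_def by blast+
  then show ?thesis by auto
qed

lemma additive_character_sum:
  assumes "additive_character \<psi>"
  shows "\<psi> (\<Sum>i\<in>I. f i) = (\<Prod>i\<in>I. \<psi> (f i))"
  using assms additive_character_zero[OF assms]
  by (induction I rule: infinite_finite_induct) (auto simp: additive_character_def)

lemma additive_character_cnj:
  assumes "additive_character \<psi>"
  shows "cnj (\<psi> x) = \<psi> (- x)"
proof -
  have "\<psi> x * \<psi> (- x) = 1"
    using assms additive_character_zero[OF assms]
    unfolding additive_character_def by (metis add.right_inverse)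
  moreover have "norm (\<psi> x) = 1"
    using assms by (simp add: additive_character_def)
  then have "\<psi> x * cnj (\<psi> x) = 1"
    by (metis complex_norm_square of_real_1 power_one)
  ultimately have "\<psi> x * cnj (\<psi> x) = \<psi> x * \<psi> (- x)" and "\<psi> x \<noteq> 0"
    by auto
  then show ?thesis by simp
qed

lemma additive_character_orthogonality:
  fixes \<psi> :: "'a::{field,finite} \<Rightarrow> complex"
  assumes "additive_character \<psi>" and "\<psi> z \<noteq> 1"
  shows "(\<Sum>x\<in>UNIV. \<psi> (x * t)) = (if t = 0 then of_nat CARD('a) else 0)"
proof (cases "t = 0")
  case True
  then show ?thesis
    using additive_character_zero[OF assms(1)] by simp
next
  case False
  \<comment> \<open>After scaling away \<open>t\<close>, shifting by \<open>z\<close> multiplies the sum by \<open>\<psi> z \<noteq> 1\<close>.\<close>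
  have "(\<Sum>x\<in>UNIV. \<psi> (x * t)) = (\<Sum>x\<in>UNIV. \<psi> x)"
    by (rule sum.reindex_bij_witness[of _ "\<lambda>x. x / t" "\<lambda>x. x * t"]) (use False in auto)
  moreover have "\<psi> z * (\<Sum>x\<in>UNIV. \<psi> x) = (\<Sum>x\<in>UNIV. \<psi> (z + x))"
    using assms(1) by (simp add: additive_character_def sum_distrib_left)
  moreover have "(\<Sum>x\<in>UNIV. \<psi> (z + x)) = (\<Sum>x\<in>UNIV. \<psi> x)"
    by (rule sum.reindex_bij_witness[of _ "\<lambda>x. x - z" "\<lambda>x. z + x"]) auto
  ultimately have "(\<psi> z - 1) * (\<Sum>x\<in>UNIV. \<psi> (x * t)) = 0"
    by (simp add: algebra_simps)
  with assms(2) False show ?thesis by simp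
qed

lemma norm_permanent_character_le:
  fixes \<psi> :: "'a::{field,finite} \<Rightarrow> complex"
  assumes \<psi>: "additive_character \<psi>" "\<psi> z \<noteq> 1" and t: "t \<noteq> 0"
  shows "norm (permanent (\<lambda>c d. \<psi> (t * (c * d)))) \<le> sqrt (real CARD('a)) ^ CARD('a)"
proof (rule norm_permanent_le)
  fix j k :: 'a
  have "\<psi> (t * (c * j)) * cnj (\<psi> (t * (c * k))) = \<psi> (c * (t * (j - k)))" for c
  proof -
    have "\<psi> (t * (c * j)) * cnj (\<psi> (t * (c * k))) = \<psi> (t * (c * j) + - (t * (c * k)))"
      using \<psi>(1) unfolding additive_character_cnj[OF \<psi>(1)] additive_character_def by metis
    then show ?thesis by (simp add: algebra_simps)
  qed
  then show "(\<Sum>c\<in>UNIV. \<psi> (t * (c * j)) * cnj (\<psi> (t * (c * k))))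
      = (if j = k then of_real (real CARD('a)) else 0)"
    using additive_character_orthogonality[OF \<psi>, of "t * (j - k)"] t by simp
qed


section \<open>Bijections with vanishing first moment\<close>

lemma card_bijections: "card {\<sigma> :: 'n::finite \<Rightarrow> 'n. bij \<sigma>} = fact CARD('n)"
proof -
  have "{\<sigma> :: 'n \<Rightarrow> 'n. bij \<sigma>} = {\<sigma>. \<sigma> permutes UNIV}"
    by (simp add: bij_iff permutes_univ)
  then show ?thesis
    by (simp add: card_permutations)
qed

text \<open>
  By orthogonality, \<open>q\<close> times the number of solutions is the sum over \<open>t\<close> of the permanents
  of \<open>\<psi> (t * (c * d))\<close>. The summand at \<open>t = 0\<close> is the main term \<open>q!\<close>, and the others are bounded
  by \<open>norm_permanent_character_le\<close>.
\<close>

theorem card_bij_sum_eq_0_bound: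
  assumes "prime p" and "r \<ge> 1" and "CARD('a::{field,finite}) = p ^ r"
  defines "q \<equiv> CARD('a)"
  shows "\<bar>real q * real (card {\<sigma> :: 'a \<Rightarrow> 'a. bij \<sigma> \<and> (\<Sum>c\<in>UNIV. c * \<sigma> c) = 0}) - fact q\<bar>
           \<le> (real q - 1) * sqrt (real q) ^ q"
proof -
  obtain \<psi> :: "'a \<Rightarrow> complex" and z where \<psi>: "additive_character \<psi>" "\<psi> z \<noteq> 1"
    using exists_nontrivial_additive_character[OF assms(1-3)] .
  let ?e = "\<lambda>\<sigma> :: 'a \<Rightarrow> 'a. \<Sum>c\<in>UNIV. c * \<sigma> c"
  let ?S = "{\<sigma> :: 'a \<Rightarrow> 'a. bij \<sigma> \<and> ?e \<sigma> = 0}"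
  let ?per = "\<lambda>t. permanent (\<lambda>c d. \<psi> (t * (c * d)))"
  have "of_nat q * of_nat (card ?S) = (\<Sum>\<sigma> | bij \<sigma>. if ?e \<sigma> = 0 then of_nat q else 0 :: complex)"
    by (simp add: sum.If_cases Int_def mult.commute)
  also have "\<dots> = (\<Sum>\<sigma> | bij \<sigma>. \<Sum>t\<in>UNIV. \<psi> (t * ?e \<sigma>))"
    by (simp only: additive_character_orthogonality[OF \<psi>] q_def)
  also have "\<dots> = (\<Sum>t\<in>UNIV. ?per t)"
    by (subst sum.swap) (simp add: permanent_def sum_distrib_left additive_character_sum[OF \<psi>(1)])
  also have "\<dots> = ?per 0 + (\<Sum>t\<in>UNIV - {0}. ?per t)"
    by (rule sum.remove) simp_all
  also have "?per 0 = fact q"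
    using card_bijections[where 'n='a] additive_character_zero[OF \<psi>(1)]
    by (simp add: permanent_def q_def)
  finally have sum_eq: "complex_of_real (real q * real (card ?S) - fact q) = (\<Sum>t\<in>UNIV - {0}. ?per t)"
    by simp
  have "\<bar>real q * real (card ?S) - fact q\<bar> = norm (\<Sum>t\<in>UNIV - {0}. ?per t)"
    unfolding sum_eq[symmetric] norm_of_real ..
  also have "\<dots> \<le> (\<Sum>t\<in>UNIV - {0 :: 'a}. sqrt (real q) ^ q)"
    unfolding q_def by (intro sum_norm_le norm_permanent_character_le[OF \<psi>]) auto
  also have "\<dots> = (real q - 1) * sqrt (real q) ^ q"
    by (simp add: card_Diff_singleton q_def of_nat_diff)
  finally show ?thesis .
qed


section \<open>Degrees of interpolation polynomials\<close>

text \<open>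
  The factor \<open>1 - (X - c)^(q-1)\<close> is the Lagrange basis polynomial at \<open>c\<close>: by Fermat's little
  theorem it is \<open>1\<close> at \<open>c\<close> and \<open>0\<close> elsewhere. In this form its coefficients can be read off
  from the binomial theorem.
\<close>

definition interpolant :: "('a::{field,finite} \<Rightarrow> 'a) \<Rightarrow> 'a poly" where
  "interpolant f = (\<Sum>c\<in>UNIV. smult (f c) (1 - [:- c, 1:] ^ (CARD('a) - 1)))"

lemma card_field_ge_2: "CARD('a::{field,finite}) \<ge> 2"
proof -
  have "card {0, 1 :: 'a} \<le> CARD('a)"
    by (rule card_mono) auto
  then show ?thesis by simp
qed

lemma poly_interpolant:
  fixes f :: "'a::{field,finite} \<Rightarrow> 'a"
  shows "poly (interpolant f) = f"
proof
  fix x :: 'a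
  have "poly (1 - [:- c, 1:] ^ (CARD('a) - 1)) x = (if c = x then 1 else 0)" for c
    using card_field_ge_2[where 'a='a] power_card_minus_1_eq_1[of "x - c"]
    by (auto simp: poly_power power_0_left)
  then have "poly (interpolant f) x = (\<Sum>c\<in>UNIV. f c * (if c = x then 1 else 0))"
    by (simp only: interpolant_def poly_sum poly_smult)
  then show "poly (interpolant f) x = f x"
    by (simp add: if_distrib cong: if_cong)
qed

lemma degree_interpolant:
  fixes f :: "'a::{field,finite} \<Rightarrow> 'a"
  shows "degree (interpolant f) \<le> CARD('a) - 1"
  unfolding interpolant_def
  by (intro degree_sum_le order_trans[OF degree_smult_le] degree_diff_le)
     (auto simp: degree_linear_power)

lemma poly_eq_interpolant:
  fixes f :: "'a::{field,finite} poly"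
  assumes "degree f < CARD('a)"
  shows "f = interpolant (poly f)"
  using assms degree_interpolant[of "poly f"] card_field_ge_2[where 'a='a]
  by (intro poly_eqI_degree[where A = UNIV]) (auto simp: poly_interpolant)

lemma coeff_interpolant_card_minus_1:
  fixes f :: "'a::{field,finite} \<Rightarrow> 'a"
  shows "coeff (interpolant f) (CARD('a) - 1) = - (\<Sum>c\<in>UNIV. f c)"
  using card_field_ge_2[where 'a='a]
  by (simp add: interpolant_def coeff_sum coeff_linear_poly_power coeff_1 sum_negf)

text \<open>
  The coefficient of \<open>X^(q-2)\<close> in \<open>(X - c)^(q-1)\<close> is \<open>(q - 1) * (- c) = c\<close>, because \<open>q\<close> is zero
  in the field. For \<open>q = 2\<close> this would be the constant coefficient, to which the summand \<open>1\<close> of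
  each basis polynomial also contributes.
\<close>

lemma coeff_interpolant_card_minus_2:
  fixes f :: "'a::{field,finite} \<Rightarrow> 'a"
  assumes "CARD('a) > 2"
  shows "coeff (interpolant f) (CARD('a) - 2) = - (\<Sum>c\<in>UNIV. c * f c)"
proof -
  define m where "m = CARD('a) - 2"
  have m: "CARD('a) - 1 = Suc m" "m > 0"
    using assms by (auto simp: m_def)
  have "of_nat (Suc m) + 1 = (0 :: 'a)"
    using of_nat_card_eq_0[where 'a='a] assms
    by (metis m(1) of_nat_Suc Suc_diff_1 add.commute zero_less_card_finite)
  then have neg1: "of_nat (Suc m) = (- 1 :: 'a)"
    by (simp only: eq_neg_iff_add_eq_0)
  have "coeff ([:- c, 1:] ^ Suc m) m = c" for c :: 'a
    using neg1 by (subst coeff_linear_poly_power) (simp_all del: of_nat_Suc power_Suc)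
  then show ?thesis
    using m(2) unfolding interpolant_def m(1)
    by (simp add: coeff_sum coeff_1 sum_negf mult.commute del: power_Suc flip: m_def)
qed

text \<open>
  A field with more than two elements contains some \<open>t\<close> other than \<open>0\<close> and \<open>1\<close>, and scaling by
  \<open>t\<close> only permutes the summands.
\<close>

lemma sum_field_elements_eq_0:
  assumes "CARD('a::{field,finite}) > 2"
  shows "(\<Sum>c\<in>UNIV. c) = (0 :: 'a)"
proof -
  have "\<not> UNIV \<subseteq> {0, 1 :: 'a}"
    using assms card_mono[of "{0, 1 :: 'a}" UNIV] by auto
  then obtain t :: 'a where t: "t \<noteq> 0" "t \<noteq> 1" by blast
  have "(\<Sum>c\<in>UNIV. t * c) = (\<Sum>c\<in>UNIV. c)"
    by (rule sum.reindex_bij_witness[of _ "\<lambda>c. c / t" "\<lambda>c. t * c"]) (use t in auto)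
  then have "t * (\<Sum>c\<in>UNIV. c) = (\<Sum>c\<in>UNIV. c)"
    by (simp add: sum_distrib_left)
  with t show ?thesis by simp
qed

lemma degree_interpolant_bij:
  fixes \<sigma> :: "'a::{field,finite} \<Rightarrow> 'a"
  assumes "CARD('a) > 2" and "bij \<sigma>"
  shows "degree (interpolant \<sigma>) = CARD('a) - 2 \<longleftrightarrow> (\<Sum>c\<in>UNIV. c * \<sigma> c) \<noteq> 0"
proof -
  have "(\<Sum>c\<in>UNIV. \<sigma> c) = 0"
    using sum.reindex_bij_betw[OF assms(2), of "\<lambda>c. c"] sum_field_elements_eq_0[OF assms(1)] by simp
  then have top: "coeff (interpolant \<sigma>) (CARD('a) - 1) = 0"
    unfolding coeff_interpolant_card_minus_1 by simp
  have deg: "degree (interpolant \<sigma>) \<le> CARD('a) - 2"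
  proof (rule degree_le, intro allI impI)
    fix i assume "i > CARD('a) - 2"
    then have "i = CARD('a) - 1 \<or> i > CARD('a) - 1" using assms(1) by linarith
    then show "coeff (interpolant \<sigma>) i = 0"
      using top degree_interpolant[of \<sigma>] by (auto intro: coeff_eq_0)
  qed
  have "degree (interpolant \<sigma>) = CARD('a) - 2 \<longleftrightarrow> coeff (interpolant \<sigma>) (CARD('a) - 2) \<noteq> 0"
  proof
    assume d: "degree (interpolant \<sigma>) = CARD('a) - 2"
    then have "interpolant \<sigma> \<noteq> 0"
      using assms(1) by auto
    with d show "coeff (interpolant \<sigma>) (CARD('a) - 2) \<noteq> 0"
      by (metis leading_coeff_0_iff)
  next
    assume "coeff (interpolant \<sigma>) (CARD('a) - 2) \<noteq> 0"
    with deg show "degree (interpolant \<sigma>) = CARD('a) - 2"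
      using le_degree by (blast intro: antisym)
  qed
  then show ?thesis
    by (simp add: coeff_interpolant_card_minus_2[OF assms(1)])
qed


section \<open>Counting permutation polynomials\<close>

lemma num_permutation_polys_eq_card_bij:
  assumes "CARD('a::{field,finite}) > 2"
  shows "num_permutation_polys TYPE('a) (CARD('a) - 2)
    = card {\<sigma> :: 'a \<Rightarrow> 'a. bij \<sigma> \<and> \<sigma> 0 = 0 \<and> (\<Sum>c\<in>UNIV. c * \<sigma> c) \<noteq> 0}"
proof -
  let ?F = "{f :: 'a poly. permutation_poly f \<and> degree f = CARD('a) - 2 \<and> poly f 0 = 0}"
  let ?M = "{\<sigma> :: 'a \<Rightarrow> 'a. bij \<sigma> \<and> \<sigma> 0 = 0 \<and> (\<Sum>c\<in>UNIV. c * \<sigma> c) \<noteq> 0}"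
  have interp: "interpolant (poly f) = f" if "f \<in> ?F" for f
    using that assms by (intro poly_eq_interpolant[symmetric]) auto
  have "bij_betw poly ?F ?M"
  proof (rule bij_betw_byWitness[where f' = interpolant])
    show "\<forall>f\<in>?F. interpolant (poly f) = f"
      using interp by blast
    show "poly ` ?F \<subseteq> ?M"
      using interp degree_interpolant_bij[OF assms]
      by (fastforce simp: permutation_poly_def)
    show "interpolant ` ?M \<subseteq> ?F"
      using degree_interpolant_bij[OF assms]
      by (auto simp: permutation_poly_def poly_interpolant)
  qed (simp add: poly_interpolant)
  then show ?thesis
    unfolding num_permutation_polys_def by (rule bij_betw_same_card)
qed

text \<open>
  Every bijection is uniquely one fixing \<open>0\<close> plus a constant \<open>a\<close>. The constant changes the moment
  \<open>\<Sum>c. c * \<sigma> c\<close> by \<open>a * (\<Sum>c. c) = 0\<close>.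
\<close>

lemma card_field_times_card_bij_fixing_0:
  assumes "CARD('a::{field,finite}) > 2"
  shows "CARD('a) * card {\<sigma> :: 'a \<Rightarrow> 'a. bij \<sigma> \<and> \<sigma> 0 = 0 \<and> (\<Sum>c\<in>UNIV. c * \<sigma> c) \<noteq> 0}
    = card {\<sigma> :: 'a \<Rightarrow> 'a. bij \<sigma> \<and> (\<Sum>c\<in>UNIV. c * \<sigma> c) \<noteq> 0}"
proof -
  let ?M = "{\<sigma> :: 'a \<Rightarrow> 'a. bij \<sigma> \<and> \<sigma> 0 = 0 \<and> (\<Sum>c\<in>UNIV. c * \<sigma> c) \<noteq> 0}"
  let ?T = "{\<sigma> :: 'a \<Rightarrow> 'a. bij \<sigma> \<and> (\<Sum>c\<in>UNIV. c * \<sigma> c) \<noteq> 0}"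
  have sum: "(\<Sum>c\<in>UNIV. c * (\<sigma> c + a)) = (\<Sum>c\<in>UNIV. c * \<sigma> c)" for \<sigma> :: "'a \<Rightarrow> 'a" and a
    using sum_field_elements_eq_0[OF assms] by (simp add: ring_distribs sum.distrib flip: sum_distrib_right)
  have bij: "bij (\<lambda>x. \<sigma> x + a)" if "bij \<sigma>" for \<sigma> :: "'a \<Rightarrow> 'a" and a
    using bij_comp[OF that, of "\<lambda>x. x + a"] by (simp add: comp_def bij_plus_right)
  have "bij_betw (\<lambda>(a, \<sigma>) x. \<sigma> x + a) (UNIV \<times> ?M) ?T"
    by (rule bij_betw_byWitness[where f' = "\<lambda>\<tau>. (\<tau> 0, \<lambda>x. \<tau> x + (- \<tau> 0))"])
       (auto simp: sum bij simp del: add_uminus_conv_diff)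
  from bij_betw_same_card[OF this] show ?thesis
    by (simp add: card_cartesian_product)
qed

lemma num_permutation_polys_bound:
  assumes "prime p" and "r \<ge> 1" and "CARD('a::{field,finite}) = p ^ r"
  defines "q \<equiv> CARD('a)"
  assumes q: "q > 2"
  shows "\<bar>real q ^ 2 * real (num_permutation_polys TYPE('a) (q - 2)) - (real q - 1) * fact q\<bar>
           \<le> (real q - 1) * sqrt (real q) ^ q"
proof -
  let ?S = "{\<sigma> :: 'a \<Rightarrow> 'a. bij \<sigma> \<and> (\<Sum>c\<in>UNIV. c * \<sigma> c) = 0}"
  let ?T = "{\<sigma> :: 'a \<Rightarrow> 'a. bij \<sigma> \<and> (\<Sum>c\<in>UNIV. c * \<sigma> c) \<noteq> 0}"
  have "card ?S + card ?T = card (?S \<union> ?T)"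
    by (rule card_Un_disjoint[symmetric]) auto
  also have "?S \<union> ?T = {\<sigma>. bij \<sigma>}" by auto
  finally have "card ?S + card ?T = fact q"
    by (simp add: card_bijections q_def)
  moreover have "card ?T = q * num_permutation_polys TYPE('a) (q - 2)"
    using q unfolding q_def by (simp add: num_permutation_polys_eq_card_bij card_field_times_card_bij_fixing_0)
  ultimately have "card ?S + q * num_permutation_polys TYPE('a) (q - 2) = fact q"
    by (simp only:)
  then have "real (card ?S + q * num_permutation_polys TYPE('a) (q - 2)) = real (fact q)"
    by (simp only:)
  then have S: "real (card ?S) = fact q - real q * real (num_permutation_polys TYPE('a) (q - 2))"
    by (simp only: of_nat_add of_nat_mult of_nat_fact eq_diff_eq)
  show ?thesis
    using card_bij_sum_eq_0_bound[OF assms(1-3)] unfolding q_def[symmetric] S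
    by (simp add: algebra_simps power2_eq_square abs_minus_commute)
qed

theorem theorem3p1:
  fixes p r q :: nat
  assumes "prime p" and "r \<ge> 1" and "q = p ^ r"
    and "card (UNIV :: 'a::{field,finite} set) = q"
  shows "(1 - 1 / real q) * (fact (q - 1) - 1 / (real q - 1) * real q powr (real q / 2))
           \<le> real (num_permutation_polys TYPE('a) (q - 2))
          \<and> real (num_permutation_polys TYPE('a) (q - 2))
           \<le> (1 - 1 / real q) * (fact (q - 1) + 1 / (real q - 1) * real q powr (real q / 2))"
proof (cases "q > 2")
  case False
  then have q: "q = 2"
    using card_field_ge_2[where 'a='a] assms(4) by simp
  \<comment> \<open>Here \<open>q - 2 = 0\<close>, and constants are not permutations; the lower bound is negative.\<close>
  have "\<not> permutation_poly f" if "degree f = 0" for f :: "'a poly"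
  proof
    assume "permutation_poly f"
    then have "poly f 0 \<noteq> poly f 1"
      by (simp add: permutation_poly_def bij_def inj_eq)
    with that show False
      by (auto elim: degree_eq_zeroE)
  qed
  then have "num_permutation_polys TYPE('a) 0 = 0"
    unfolding num_permutation_polys_def by (metis (mono_tags, lifting) card.empty empty_Collect_eq)
  then show ?thesis
    by (simp add: q)
next
  case True
  let ?N = "real (num_permutation_polys TYPE('a) (q - 2))"
  define R where "R = sqrt (real q) ^ q"
  have R: "real q powr (real q / 2) = R" "R \<ge> 0"
    using True by (simp_all add: R_def powr_half_sqrt[symmetric] powr_power)
  have fact: "(fact q :: real) = real q * fact (q - 1)"
    using True by (simp add: fact_reduce)
  have "\<bar>(real q)\<^sup>2 * ?N - (real q - 1) * (real q * fact (q - 1))\<bar> \<le> (real q - 1) * R"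
    using num_permutation_polys_bound[OF assms(1,2) assms(4)[unfolded assms(3)]] True
    unfolding assms(3)[symmetric] assms(4) R_def fact by blast
  also have "\<dots> \<le> real q * R"
    using R(2) by (intro mult_right_mono) auto
  finally have "\<bar>real q * (real q * ?N - (real q - 1) * fact (q - 1))\<bar> \<le> real q * R"
    by (simp add: algebra_simps power2_eq_square)
  then have "\<bar>real q * ?N - (real q - 1) * fact (q - 1)\<bar> \<le> R"
    using True by (simp add: abs_mult)
  then have "(real q - 1) * fact (q - 1) - R \<le> real q * ?N"
    and "real q * ?N \<le> (real q - 1) * fact (q - 1) + R"
    by linarith+
  then have "((real q - 1) * fact (q - 1) - R) / real q \<le> ?N"
    and "?N \<le> ((real q - 1) * fact (q - 1) + R) / real q"
    using True by (simp_all add: pos_divide_le_eq pos_le_divide_eq mult.commute[of ?N])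
  moreover have "(1 - 1 / real q) * (fact (q - 1) - 1 / (real q - 1) * R) = ((real q - 1) * fact (q - 1) - R) / real q"
    and "(1 - 1 / real q) * (fact (q - 1) + 1 / (real q - 1) * R) = ((real q - 1) * fact (q - 1) + R) / real q"
    using True by (simp_all add: field_simps)
  ultimately show ?thesis
    unfolding R(1) by (simp only:)
qed

end
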